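(* Suppose $(k_1,V_1,U_1)$ and $(k_2,V_2,U_2)$ are finite-dimensional definable projective spaces of dimension at least $2$. Let $\varphi:\mathbf P(V_1)\to\mathbf P(V_2)$ be an injection (of sets of rational points) that induces an inclusion $\lambda:U_1\to U_2$, i.e. for every line $\ell\in U_1$ the image $\varphi(\ell)$ is a line belonging to $U_2$. Then there are an isomorphism of fields $\sigma:k_1\to k_2$ and a $\sigma$-linear injective map of vector spaces $\psi:V_1\to V_2$ such that $\mathbf P(\psi)$ agrees with $\varphi$ on a Zariski-dense open subset of $\mathbf P(V_1)$ containing the sweep of $(k_1,V_1,U_1^\circ)$.
   Context: For a vector space $V$ over a field $k$, $\mathbf P(V)$ is the projective space of lines through the origin in $V$, and $\operatorname{Gr}(1,\mathbf P(V))$ is the Grassmannian of (projective) lines in $\mathbf P(V)$. A definable projective space is a triple $(k,V,U)$ consisting of an infinite field $k$, a $k$-vector space $V$, and a subset $U\subset\operatorname{Gr}(1,\mathbf P(V))(k)$ which contains the $k$-points of a dense Zariski open subset of $\operatorname{Gr}(1,\mathbf P(V))$. Its dimension is $\dim_kV-1$. The set $U^\circ\subset U$ is the maximal subset of $U$ which is the set of $k$-points of a Zariski open subset of $\operatorname{Gr}(1,\mathbf P(V))$; then $(k,V,U^\circ)$ is again a definable projective space. The sweep of $(k,V,U)$ (of $U$) is the set of $k$-points $p\in\mathbf P(V)$ that lie on some line parametrized by $U$. A map $\psi$ is $\sigma$-linear if it is additive and $\psi(av)=\sigma(a)\psi(v)$; $\mathbf P(\psi)$ denotes the induced map on projective spaces.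 *)

theory Defs
  imports "HOL-Analysis.Abstract_Topology"
begin

text \<open>
  The points of \<open>P(V)\<close> are the lines through the origin and the lines of \<open>P(V)\<close> are the planes
  through the origin, where \<open>V\<close> is a whole type with scalar multiplication \<open>scale\<close>.
\<close>

definition proj_points :: "('k::field \<Rightarrow> 'v::ab_group_add \<Rightarrow> 'v) \<Rightarrow> 'v set set" where
  "proj_points scale = {p. module.subspace scale p \<and> vector_space.dim scale p = 1}"

definition proj_lines :: "('k::field \<Rightarrow> 'v::ab_group_add \<Rightarrow> 'v) \<Rightarrow> 'v set set" where
  "proj_lines scale = {l. module.subspace scale l \<and> vector_space.dim scale l = 2}"

definition points_on :: "('k::field \<Rightarrow> 'v::ab_group_add \<Rightarrow> 'v) \<Rightarrow> 'v set \<Rightarrow> 'v set set" where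
  "points_on scale l = {p \<in> proj_points scale. p \<subseteq> l}"

text \<open>The integer-valued difference avoids truncated subtraction for \<open>V = 0\<close>.\<close>

definition proj_dim :: "('k::field \<Rightarrow> 'v::ab_group_add \<Rightarrow> 'v) \<Rightarrow> int" where
  "proj_dim scale = int (vector_space.dim scale (UNIV :: 'v set)) - 1"

text \<open>
  \<open>homogeneous_poly C d F\<close>: \<open>F\<close> is a homogeneous polynomial of degree \<open>d\<close> in finitely many of the
  coordinate functions in \<open>C\<close>.  Polynomials enter only through the functions they define.
\<close>

inductive homogeneous_poly :: "('a \<Rightarrow> 'k::comm_ring_1) set \<Rightarrow> nat \<Rightarrow> ('a \<Rightarrow> 'k) \<Rightarrow> bool"
  for C :: "('a \<Rightarrow> 'k) set" where
  const: "homogeneous_poly C 0 (\<lambda>_. c)"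
| coord: "f \<in> C \<Longrightarrow> homogeneous_poly C 1 f"
| add: "homogeneous_poly C d F \<Longrightarrow> homogeneous_poly C d G \<Longrightarrow>
    homogeneous_poly C d (\<lambda>x. F x + G x)"
| mult: "homogeneous_poly C d F \<Longrightarrow> homogeneous_poly C e G \<Longrightarrow>
    homogeneous_poly C (d + e) (\<lambda>x. F x * G x)"

definition linear_forms :: "('k::field \<Rightarrow> 'v::ab_group_add \<Rightarrow> 'v) \<Rightarrow> ('v \<Rightarrow> 'k) set" where
  "linear_forms scale = {f. Vector_Spaces.linear scale (*) f}"

text \<open>
  The value at \<open>(x, y)\<close> is that of the linear form \<open>f \<and> g\<close> on the bivector \<open>x \<and> y\<close>.  For \<open>f\<close>, \<open>g\<close>
  ranging over the dual of a basis of \<open>V\<close> these are the usual Pluecker coordinates of the plane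
  spanned by \<open>x\<close> and \<open>y\<close>.
\<close>

definition plucker_coords ::
    "('k::field \<Rightarrow> 'v::ab_group_add \<Rightarrow> 'v) \<Rightarrow> ('v \<times> 'v \<Rightarrow> 'k) set" where
  "plucker_coords scale =
    {(\<lambda>(x, y). f x * g y - f y * g x) | f g. f \<in> linear_forms scale \<and> g \<in> linear_forms scale}"

text \<open>
  The Zariski topologies on the rational points of \<open>P(V)\<close> and of \<open>Gr(1, P(V))\<close>, given by their
  principal open sets \<open>F \<noteq> 0\<close>.  By homogeneity the condition \<open>F \<noteq> 0\<close> does not depend on the chosen
  spanning vectors.
\<close>

definition principal_open_points ::
    "('k::field \<Rightarrow> 'v::ab_group_add \<Rightarrow> 'v) \<Rightarrow> ('v \<Rightarrow> 'k) \<Rightarrow> 'v set set" where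
  "principal_open_points scale F =
    {p \<in> proj_points scale. \<exists>x. p = module.span scale {x} \<and> F x \<noteq> 0}"

definition zariski_points :: "('k::field \<Rightarrow> 'v::ab_group_add \<Rightarrow> 'v) \<Rightarrow> 'v set topology" where
  "zariski_points scale = topology_generated_by
    {principal_open_points scale F | F d. homogeneous_poly (linear_forms scale) d F}"

definition principal_open_lines ::
    "('k::field \<Rightarrow> 'v::ab_group_add \<Rightarrow> 'v) \<Rightarrow> ('v \<times> 'v \<Rightarrow> 'k) \<Rightarrow> 'v set set" where
  "principal_open_lines scale F =
    {l \<in> proj_lines scale. \<exists>x y. l = module.span scale {x, y} \<and> F (x, y) \<noteq> 0}"

definition zariski_lines :: "('k::field \<Rightarrow> 'v::ab_group_add \<Rightarrow> 'v) \<Rightarrow> 'v set topology" where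
  "zariski_lines scale = topology_generated_by
    {principal_open_lines scale F | F d. homogeneous_poly (plucker_coords scale) d F}"

definition dense_open :: "'a topology \<Rightarrow> 'a set \<Rightarrow> bool" where
  "dense_open X D \<longleftrightarrow> openin X D \<and> X closure_of D = topspace X"

lemma (in vector_space) span_basis_of_dim:
  assumes "subspace W"
  obtains B where "card B = dim W" "span B = W"
  using assms basis_exists[of W] span_subspace by metis

lemma topspace_zariski_points:
  assumes "vector_space scale"
  shows "topspace (zariski_points scale) = proj_points scale"
proof -
  interpret vector_space scale by fact
  have "\<exists>x. p = span {x}" if "p \<in> proj_points scale" for p
    using that span_basis_of_dim[of p] unfolding proj_points_def
    by (metis (mono_tags, lifting) card_1_singletonE mem_Collect_eq)
  then have "principal_open_points scale (\<lambda>_. 1) = proj_points scale"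
    by (auto simp: principal_open_points_def)
  moreover have "principal_open_points scale F \<subseteq> proj_points scale" for F
    by (auto simp: principal_open_points_def)
  ultimately show ?thesis
    unfolding zariski_points_def topology_generated_by_topspace
    by (blast intro: homogeneous_poly.const)
qed

lemma topspace_zariski_lines:
  assumes "vector_space scale"
  shows "topspace (zariski_lines scale) = proj_lines scale"
proof -
  interpret vector_space scale by fact
  have "\<exists>x y. l = span {x, y}" if "l \<in> proj_lines scale" for l
    using that span_basis_of_dim[of l] unfolding proj_lines_def
    by (metis (mono_tags, lifting) card_2_iff mem_Collect_eq)
  then have "principal_open_lines scale (\<lambda>_. 1) = proj_lines scale"
    by (auto simp: principal_open_lines_def)
  moreover have "principal_open_lines scale F \<subseteq> proj_lines scale" for F
    by (auto simp: principal_open_lines_def)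
  ultimately show ?thesis
    unfolding zariski_lines_def topology_generated_by_topspace
    by (blast intro: homogeneous_poly.const)
qed

text \<open>
  Over an infinite field a Zariski open subscheme of the Grassmannian is dense iff its set of
  rational points is dense among all rational points, so density is expressed on rational points.
\<close>

definition definable_projective_space ::
    "('k::field \<Rightarrow> 'v::ab_group_add \<Rightarrow> 'v) \<Rightarrow> 'v set set \<Rightarrow> bool" where
  "definable_projective_space scale U \<longleftrightarrow>
    infinite (UNIV :: 'k set) \<and> vector_space scale \<and> U \<subseteq> proj_lines scale \<and>
    (\<exists>D \<subseteq> U. dense_open (zariski_lines scale) D)"

definition open_part ::
    "('k::field \<Rightarrow> 'v::ab_group_add \<Rightarrow> 'v) \<Rightarrow> 'v set set \<Rightarrow> 'v set set" where
  "open_part scale U = zariski_lines scale interior_of U"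

definition sweep ::
    "('k::field \<Rightarrow> 'v::ab_group_add \<Rightarrow> 'v) \<Rightarrow> 'v set set \<Rightarrow> 'v set set" where
  "sweep scale U = {p \<in> proj_points scale. \<exists>l \<in> U. p \<in> points_on scale l}"

definition field_iso :: "('k1::field \<Rightarrow> 'k2::field) \<Rightarrow> bool" where
  "field_iso \<sigma> \<longleftrightarrow> bij \<sigma> \<and> \<sigma> 1 = 1 \<and>
    (\<forall>a b. \<sigma> (a + b) = \<sigma> a + \<sigma> b) \<and> (\<forall>a b. \<sigma> (a * b) = \<sigma> a * \<sigma> b)"

definition semilinear ::
    "('k1::field \<Rightarrow> 'k2::field) \<Rightarrow> ('k1 \<Rightarrow> 'v1::ab_group_add \<Rightarrow> 'v1) \<Rightarrow>
     ('k2 \<Rightarrow> 'v2::ab_group_add \<Rightarrow> 'v2) \<Rightarrow> ('v1 \<Rightarrow> 'v2) \<Rightarrow> bool" where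
  "semilinear \<sigma> scale1 scale2 \<psi> \<longleftrightarrow>
    (\<forall>v w. \<psi> (v + w) = \<psi> v + \<psi> w) \<and> (\<forall>a v. \<psi> (scale1 a v) = scale2 (\<sigma> a) (\<psi> v))"

text \<open>
  \<open>P(\<psi>)\<close> sends a point to its image under \<open>\<psi>\<close>, which is again a line through the origin when
  \<open>\<psi>\<close> is injective and semilinear over an isomorphism of fields.
\<close>

definition proj_map :: "('v1 \<Rightarrow> 'v2) \<Rightarrow> 'v1 set \<Rightarrow> 'v2 set" where
  "proj_map \<psi> p = \<psi> ` p"

end

theory Submission
  imports Defs "HOL-Computational_Algebra.Polynomial"
begin

text \<open>
  Fix a nonzero vector \<open>v0\<close> lying on some line of the open part \<open>U\<close> of \<open>U1\<close>, and a vector \<open>h0\<close>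
  spanning the image of the point of \<open>v0\<close>.  If \<open>v0\<close> and \<open>v\<close> span a line of \<open>U\<close>, then that line is
  mapped onto a line, so the image of \<open>\<langle>v0 + v\<rangle>\<close> is a third point on the line joining the
  images of \<open>\<langle>v0\<rangle>\<close> and \<open>\<langle>v\<rangle>\<close>.  Hence there is exactly one vector \<open>lift v\<close> that spans the image of
  \<open>\<langle>v\<rangle>\<close> and for which \<open>h0 + lift v\<close> spans the image of \<open>\<langle>v0 + v\<rangle>\<close>.  So a choice at one point fixes
  the scaling at all generic points.

  This lift is additive at \<open>v\<close> and \<open>w\<close> in general position (\<open>lift_add\<close>):
  the image of \<open>\<langle>v0 + v + w\<rangle>\<close> lies on the line through the images of \<open>\<langle>v0 + v\<rangle>\<close> and \<open>\<langle>w\<rangle>\<close> and on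
  the line through those of \<open>\<langle>v0 + w\<rangle>\<close> and \<open>\<langle>v\<rangle>\<close>, and two such lines have one common point.  For
  given \<open>v\<close> this covers all generic \<open>w\<close>, and a generically additive map is the restriction of a
  unique homomorphism \<open>\<psi>\<close> of the whole group (\<open>generically_additive_extends\<close>).

  The factor by which \<open>\<psi>\<close> responds to scaling a vector by \<open>a\<close> is the same for all generic vectors,
  by comparing coefficients in \<open>\<psi> (a (v + w))\<close>; it is a field homomorphism \<open>\<sigma>\<close>, and it is onto because
  the image of the line through \<open>v0\<close> and \<open>v\<close> is a whole line (\<open>scalar_map_surj\<close>).  Finally, if
  \<open>\<langle>v\<rangle>\<close> is any point of the sweep of \<open>U\<close>, then \<open>\<psi> v\<close> lies on the images of two different lines of
  \<open>U\<close> through \<open>\<langle>v\<rangle>\<close>, so it spans the image of \<open>\<langle>v\<rangle>\<close> (\<open>\<psi>_represents_swept\<close>).  The sweep itself is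
  open and dense (\<open>dense_open_sweep\<close>) and serves as the set on which the two maps agree.

  All choices of generic vectors rest on one property of Zariski open sets: an affine line meets
  them in the empty set or in all but finitely many of its points.
\<close>

section \<open>Subspaces of dimension at most two\<close>

context vector_space
begin

lemma span_pair: "span {v, w} = {a *s v + b *s w | a b. True}"
  by (auto simp: span_breakdown_eq span_singleton image_iff algebra_simps) (metis diff_add_cancel add.commute)+

lemma span_pair_iff: "x \<in> span {v, w} \<longleftrightarrow> (\<exists>a b. x = a *s v + b *s w)"
  by (auto simp: span_pair)

lemma span_singleton_iff: "x \<in> span {v} \<longleftrightarrow> (\<exists>a. x = a *s v)"
  by (auto simp: span_singleton)

lemma span_singleton_eq:
  assumes "x \<in> span {v}" "x \<noteq> 0"
  shows "span {x} = span {v}"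
proof -
  obtain a where "x = a *s v"
    using assms(1) by (auto simp: span_singleton_iff)
  with assms(2) have "v = inverse a *s x"
    by auto
  then have "v \<in> span {x}"
    using span_singleton_iff by blast
  then show ?thesis
    using assms(1) by (simp add: span_eq)
qed

lemma scale_span_singleton: "c \<noteq> 0 \<Longrightarrow> span {c *s v} = span {v}"
  by (cases "v = 0") (auto intro!: span_singleton_eq simp: span_singleton_iff)

lemma span_pair_cong:
  assumes "span {v} = span {v'}"
  shows "span {v, w} = span {v', w}"
proof -
  have "span ({v} \<union> {w}) = span ({v'} \<union> {w})"
    unfolding span_Un assms ..
  then show ?thesis
    by (simp add: insert_commute)
qed

lemma span_pair_eqI:
  assumes "x \<in> span {v, w}" "y \<in> span {v, w}" "v \<in> span {x, y}" "w \<in> span {x, y}"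
  shows "span {x, y} = span {v, w}"
  using assms by (simp add: span_eq)

lemma scale_in_span_cancel: "c \<noteq> 0 \<Longrightarrow> c *s x \<in> span S \<Longrightarrow> x \<in> span S"
  using span_scale[of "c *s x" S "inverse c"] by (simp add: scale_scale)

lemma coeffs_unique_pair:
  assumes "w \<noteq> 0" "v \<notin> span {w}" "a *s v + b *s w = c *s v + d *s w"
  shows "a = c \<and> b = d"
proof -
  have "(a - c) *s v = (d - b) *s w"
    using assms(3) by (simp add: algebra_simps)
  then have "(a - c) *s v \<in> span {w}"
    by (auto simp: span_singleton_iff)
  then have "a = c"
    using assms(2) scale_in_span_cancel[of "a - c" v "{w}"] by auto
  then show ?thesis
    using assms by simp
qed

lemma coeffs_unique_triple:
  assumes "w \<noteq> 0" "v \<notin> span {w}" "u \<notin> span {v, w}"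
    and "a *s u + b *s v + c *s w = a' *s u + b' *s v + c' *s w"
  shows "a = a' \<and> b = b' \<and> c = c'"
proof -
  have "(a - a') *s u = (b' - b) *s v + (c' - c) *s w"
    using assms(4) by (simp add: algebra_simps)
  then have "(a - a') *s u \<in> span {v, w}"
    by (auto simp: span_pair_iff)
  then have "a = a'"
    using assms(3) scale_in_span_cancel[of "a - a'" u "{v, w}"] by auto
  then have "b *s v + c *s w = b' *s v + c' *s w"
    using assms(4) by (simp add: add.assoc)
  then show ?thesis
    using coeffs_unique_pair[OF assms(1,2)] \<open>a = a'\<close> by blast
qed

lemma proj_points_iff: "p \<in> proj_points (*s) \<longleftrightarrow> (\<exists>v. v \<noteq> 0 \<and> p = span {v})"
proof
  assume "p \<in> proj_points (*s)"
  then have "subspace p" "dim p = 1"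
    by (auto simp: proj_points_def)
  then obtain v where "p = span {v}"
    by (metis span_basis_of_dim card_1_singletonE)
  moreover have "v \<noteq> 0"
    using \<open>dim p = 1\<close> \<open>p = span {v}\<close> dim_le_card[of p "{}"] by auto
  ultimately show "\<exists>v. v \<noteq> 0 \<and> p = span {v}"
    by blast
next
  assume "\<exists>v. v \<noteq> 0 \<and> p = span {v}"
  then show "p \<in> proj_points (*s)"
    by (auto simp: proj_points_def simp del: dim_span intro!: dim_span_eq_card_independent[THEN trans])
qed

lemma independent_pair: "w \<noteq> 0 \<Longrightarrow> v \<notin> span {w} \<Longrightarrow> independent {v, w}"
  by (intro independent_insertI) (auto simp: dependent_def[of "{}"])

lemma proj_lines_span_iff: "span {v, w} \<in> proj_lines (*s) \<longleftrightarrow> w \<noteq> 0 \<and> v \<notin> span {w}"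
proof
  assume "w \<noteq> 0 \<and> v \<notin> span {w}"
  moreover from this have "v \<noteq> w"
    using span_base[of w "{w}"] by auto
  ultimately show "span {v, w} \<in> proj_lines (*s)"
    using dim_span_eq_card_independent[OF independent_pair[of w v]]
    by (simp add: proj_lines_def del: dim_span)
next
  assume l: "span {v, w} \<in> proj_lines (*s)"
  have "span {v, w} \<noteq> span {u}" for u
    using l dim_le_card[of "span {u}" "{u}"] by (auto simp: proj_lines_def simp del: dim_span)
  then show "w \<noteq> 0 \<and> v \<notin> span {w}"
    by (metis span_insert_0 insert_commute span_redundant)
qed

lemma proj_lines_eq_span:
  assumes "m \<in> proj_lines (*s)" "h \<in> m" "k \<in> m" "k \<noteq> 0" "h \<notin> span {k}"
  shows "m = span {h, k}"
proof
  have m: "subspace m" "dim m = 2"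
    using assms(1) by (auto simp: proj_lines_def)
  then show "span {h, k} \<subseteq> m"
    using assms by (simp add: span_minimal)
  show "m \<subseteq> span {h, k}"
  proof (rule subsetI, rule ccontr)
    fix x assume x: "x \<in> m" "x \<notin> span {h, k}"
    obtain B where B: "card B = 2" "span B = m"
      using m span_basis_of_dim by metis
    then have "finite B"
      using card.infinite by fastforce
    moreover have "independent {x, h, k}"
      using x assms by (intro independent_insertI) (auto simp: dependent_def[of "{}"])
    moreover have "{x, h, k} \<subseteq> span B"
      using B x assms by auto
    ultimately have "card {x, h, k} \<le> 2"
      using independent_span_bound B by metis
    moreover have "h \<noteq> k" "x \<noteq> h" "x \<noteq> k"
      using assms(5) x(2) by (auto simp: span_base)
    ultimately show False
      by simp
  qed
qed

lemma proj_line_cases: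
  assumes "l \<in> proj_lines (*s)"
  obtains v w where "l = span {v, w}" "w \<noteq> 0" "v \<notin> span {w}"
proof -
  obtain B where "card B = 2" "span B = l"
    using assms span_basis_of_dim[of l] by (metis (mono_tags) mem_Collect_eq proj_lines_def)
  then obtain v w where "l = span {v, w}"
    by (auto simp: card_2_iff)
  with assms that show thesis
    by (auto simp: proj_lines_span_iff)
qed

lemma proj_line_through:
  assumes "l \<in> proj_lines (*s)" "v \<in> l" "v \<noteq> 0"
  obtains w where "l = span {v, w}"
proof -
  obtain x y where xy: "l = span {x, y}" "y \<noteq> 0" "x \<notin> span {y}"
    using proj_line_cases[OF assms(1)] .
  then have mem: "x \<in> l" "y \<in> l"
    by (simp_all add: span_base)
  show thesis
  proof (cases "v \<in> span {y}")
    case True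
    then have "x \<notin> span {v}"
      using xy(3) span_singleton_eq[OF True assms(3)] by simp
    then have "l = span {x, v}"
      using proj_lines_eq_span[OF assms(1) mem(1) assms(2,3)] by blast
    then show thesis
      using that[of x] by (simp add: insert_commute)
  next
    case False
    then show thesis
      using that[of y] proj_lines_eq_span[OF assms(1,2) mem(2) xy(2)] by blast
  qed
qed

lemma span_pair_neq_UNIV:
  assumes "3 \<le> dim UNIV"
  shows "span {v, w} \<noteq> UNIV"
proof
  assume "span {v, w} = UNIV"
  then have "dim UNIV \<le> card {v, w}"
    by (intro dim_le_card) simp_all
  also have "\<dots> \<le> 2"
    by (simp add: card_insert_if)
  finally show False
    using assms by simp
qed

lemma proj_lines_nonempty:
  assumes "3 \<le> dim UNIV"
  shows "proj_lines (*s) \<noteq> {}"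
proof -
  obtain w where "w \<notin> span {0, 0}"
    using span_pair_neq_UNIV[OF assms, of 0 0] by blast
  then have "w \<noteq> 0"
    using span_zero by auto
  moreover obtain v where "v \<notin> span {w, w}"
    using span_pair_neq_UNIV[OF assms, of w w] by blast
  ultimately have "span {v, w} \<in> proj_lines (*s)"
    by (simp add: proj_lines_span_iff)
  then show ?thesis
    by blast
qed

end

section \<open>Generic vectors\<close>

text \<open>
  This property replaces Zariski openness for sets of vectors.  It is inherited by unions and
  finite intersections, and over an infinite field two nonempty sets having it always meet,
  because the line joining a point of one to a point of the other meets both in cofinite sets.
  Only polynomials in one variable are needed to establish it.
\<close>

definition linewise_cofinite :: "('k::field \<Rightarrow> 'v::ab_group_add \<Rightarrow> 'v) \<Rightarrow> 'v set \<Rightarrow> bool" where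
  "linewise_cofinite scale A \<longleftrightarrow>
    (\<forall>x y. (\<exists>t. x + scale t y \<in> A) \<longrightarrow> finite {t. x + scale t y \<notin> A})"

text \<open>
  Over an infinite field the sets that contain a nonempty \<open>linewise_cofinite\<close> set form a proper
  filter, so that finitely many generic conditions on a vector can be met at once.
\<close>

definition generic :: "('k::field \<Rightarrow> 'v::ab_group_add \<Rightarrow> 'v) \<Rightarrow> 'v filter" where
  "generic scale =
    Abs_filter (\<lambda>P. \<exists>A. linewise_cofinite scale A \<and> A \<noteq> {} \<and> (\<forall>x\<in>A. P x))"

context vector_space
begin

lemma linewise_cofinite_UNIV: "linewise_cofinite (*s) UNIV"
  by (simp add: linewise_cofinite_def)

lemma linewise_cofinite_Int:
  assumes "linewise_cofinite (*s) A" "linewise_cofinite (*s) B"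
  shows "linewise_cofinite (*s) (A \<inter> B)"
  unfolding linewise_cofinite_def
proof (intro allI impI)
  fix x y assume "\<exists>t. x + t *s y \<in> A \<inter> B"
  then have "finite ({t. x + t *s y \<notin> A} \<union> {t. x + t *s y \<notin> B})"
    using assms unfolding linewise_cofinite_def by blast
  moreover have "{t. x + t *s y \<notin> A \<inter> B} = {t. x + t *s y \<notin> A} \<union> {t. x + t *s y \<notin> B}"
    by auto
  ultimately show "finite {t. x + t *s y \<notin> A \<inter> B}"
    by simp
qed

lemma linewise_cofinite_Union:
  assumes "\<And>A. A \<in> \<A> \<Longrightarrow> linewise_cofinite (*s) A"
  shows "linewise_cofinite (*s) (\<Union>\<A>)"
  unfolding linewise_cofinite_def
proof (intro allI impI)
  fix x y assume "\<exists>t. x + t *s y \<in> \<Union>\<A>"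
  then obtain A where "A \<in> \<A>" "finite {t. x + t *s y \<notin> A}"
    using assms unfolding linewise_cofinite_def by blast
  then show "finite {t. x + t *s y \<notin> \<Union>\<A>}"
    by (auto elim: finite_subset[rotated])
qed

text \<open>
  A line with two points in \<open>W\<close> is contained in \<open>W\<close>, so any other line has at most one point there.
\<close>

lemma linewise_cofinite_Compl_subspace:
  assumes "subspace W"
  shows "linewise_cofinite (*s) (- W)"
  unfolding linewise_cofinite_def
proof (intro allI impI)
  fix x y assume "\<exists>t. x + t *s y \<in> - W"
  then obtain t0 where t0: "x + t0 *s y \<notin> W"
    by auto
  have "s = t" if "x + s *s y \<in> W" "x + t *s y \<in> W" for s t
  proof (rule ccontr)
    assume "s \<noteq> t"
    have "(x + s *s y) - (x + t *s y) \<in> W"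
      using assms that subspace_diff by blast
    then have "(s - t) *s y \<in> W"
      by (simp add: algebra_simps)
    then have "((t0 - s) * inverse (s - t)) *s ((s - t) *s y) \<in> W"
      using assms subspace_scale by blast
    then have "(t0 - s) *s y \<in> W"
      using \<open>s \<noteq> t\<close> by (simp add: mult.assoc)
    then have "(x + s *s y) + (t0 - s) *s y \<in> W"
      using assms that subspace_add by blast
    then show False
      using t0 by (simp add: algebra_simps)
  qed
  then have "{t. x + t *s y \<in> W} = {} \<or> (\<exists>s. {t. x + t *s y \<in> W} = {s})"
    by blast
  then have "finite {t. x + t *s y \<in> W}"
    by auto
  then show "finite {t. x + t *s y \<notin> - W}"
    by simp
qed

lemma linewise_cofinite_affine_vimage:
  assumes "linewise_cofinite (*s) A"
  shows "linewise_cofinite (*s) {x. u + c *s x \<in> A}"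
  unfolding linewise_cofinite_def
proof (intro allI impI)
  fix x y assume "\<exists>t. x + t *s y \<in> {x. u + c *s x \<in> A}"
  then have "\<exists>t. (u + c *s x) + t *s (c *s y) \<in> A"
    by (simp add: algebra_simps)
  then have "finite {t. (u + c *s x) + t *s (c *s y) \<notin> A}"
    using assms unfolding linewise_cofinite_def by blast
  then show "finite {t. x + t *s y \<notin> {x. u + c *s x \<in> A}}"
    by (simp add: algebra_simps)
qed

context
  assumes infinite_scalars: "infinite (UNIV :: 'a set)"
begin

lemma linewise_cofinite_Int_nonempty:
  assumes "linewise_cofinite (*s) A" "linewise_cofinite (*s) B" "a \<in> A" "b \<in> B"
  shows "A \<inter> B \<noteq> {}"
proof -
  have "a + 0 *s (b - a) \<in> A" "a + 1 *s (b - a) \<in> B"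
    using assms by auto
  then have "finite ({t. a + t *s (b - a) \<notin> A} \<union> {t. a + t *s (b - a) \<notin> B})"
    using assms(1,2) unfolding linewise_cofinite_def by blast
  then obtain t where "t \<notin> {t. a + t *s (b - a) \<notin> A} \<union> {t. a + t *s (b - a) \<notin> B}"
    using infinite_scalars by (meson ex_new_if_finite)
  then show ?thesis
    by auto
qed

lemma eventually_generic_iff:
  "eventually P (generic (*s)) \<longleftrightarrow> (\<exists>A. linewise_cofinite (*s) A \<and> A \<noteq> {} \<and> (\<forall>x\<in>A. P x))"
  unfolding generic_def
proof (rule eventually_Abs_filter, rule is_filter.intro, goal_cases)
  case 1
  show ?case
    using linewise_cofinite_UNIV by blast
next
  case (2 P Q)
  then obtain A B where "linewise_cofinite (*s) A" "A \<noteq> {}" "\<forall>x\<in>A. P x"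
    and "linewise_cofinite (*s) B" "B \<noteq> {}" "\<forall>x\<in>B. Q x"
    by blast
  then show ?case
    using linewise_cofinite_Int linewise_cofinite_Int_nonempty
    by (intro exI[of _ "A \<inter> B"]) blast
qed blast

lemma eventually_generic_obtain:
  assumes "\<forall>\<^sub>F x in generic (*s). P x"
  obtains x where "P x"
  using assms unfolding eventually_generic_iff by blast

lemma eventually_generic_affine:
  assumes "\<forall>\<^sub>F x in generic (*s). P x" "c \<noteq> 0"
  shows "\<forall>\<^sub>F x in generic (*s). P (u + c *s x)"
proof -
  obtain A a where A: "linewise_cofinite (*s) A" "a \<in> A" "\<forall>x\<in>A. P x"
    using assms(1) unfolding eventually_generic_iff by blast
  moreover have "inverse c *s (a - u) \<in> {x. u + c *s x \<in> A}"
    using \<open>c \<noteq> 0\<close> \<open>a \<in> A\<close> by (simp add: right_inverse)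
  ultimately show ?thesis
    unfolding eventually_generic_iff
    by (intro exI[of _ "{x. u + c *s x \<in> A}"]) (blast intro: linewise_cofinite_affine_vimage)
qed

lemma eventually_generic_shift:
  assumes "\<forall>\<^sub>F x in generic (*s). P x"
  shows "\<forall>\<^sub>F x in generic (*s). P (u + x)" "\<forall>\<^sub>F x in generic (*s). P (x + u)" "\<forall>\<^sub>F x in generic (*s). P (u - x)"
  using eventually_generic_affine[OF assms, of 1 u] eventually_generic_affine[OF assms, of "- 1" u]
  by (simp_all add: add.commute)

lemma eventually_generic_not_in_subspace:
  assumes "subspace W" "W \<noteq> UNIV"
  shows "\<forall>\<^sub>F x in generic (*s). x \<notin> W"
  unfolding eventually_generic_iff
  using linewise_cofinite_Compl_subspace[OF assms(1)] assms(2)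
  by (intro exI[of _ "- W"]) auto

text \<open>
  Every \<open>v\<close> is a sum of the two generic vectors \<open>x\<close> and \<open>v - x\<close>, so \<open>f x + f (v - x)\<close> is the only
  possible value of the extension at \<open>v\<close>.
\<close>

lemma generically_additive_extends:
  fixes f :: "'b \<Rightarrow> 'c::ab_group_add"
  assumes G: "\<forall>\<^sub>F x in generic (*s). G x"
    and f: "\<And>v. G v \<Longrightarrow> \<forall>\<^sub>F w in generic (*s). f (v + w) = f v + f w"
  obtains g where "\<And>v w. g (v + w) = g v + g w" "\<And>v. G v \<Longrightarrow> g v = f v"
proof -
  (* Add a generic u and compare both sides: each of the three sums below has a generic summand. *)
  have f_add: "f (v + w) = f v + f w" if "G v" "G w" "G (v + w)" for v w
  proof -
    have "\<forall>\<^sub>F u in generic (*s). f (v + w + u) = f (v + w) + f u \<and>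
        f (v + (w + u)) = f v + f (w + u) \<and> f (w + u) = f w + f u"
      using that by (intro eventually_conj f eventually_generic_shift(1)[OF f])
    then obtain u where "f (v + w + u) = f (v + w) + f u"
      "f (v + (w + u)) = f v + f (w + u)" "f (w + u) = f w + f u"
      by (rule eventually_generic_obtain) blast
    then have "f (v + w) + f u = f v + f w + f u"
      by (simp add: add.assoc)
    then show ?thesis
      by simp
  qed
  (* Two decompositions are compared through a third one that is generic for both. *)
  have well_defined: "f x + f (v - x) = f y + f (v - y)"
    if "G x" "G (v - x)" "G y" "G (v - y)" for v x y
  proof -
    have "\<forall>\<^sub>F z in generic (*s). G z \<and> G (v - z) \<and> G (x - z) \<and> G (y - z)"
      by (intro eventually_conj G eventually_generic_shift(3)[OF G])
    then obtain z where z: "G z" "G (v - z)" "G (x - z)" "G (y - z)"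
      by (rule eventually_generic_obtain) blast
    have "f x + f (v - x) = f z + f (v - z)" if "G x" "G (v - x)" "G (x - z)" for x
    proof -
      have "f x = f z + f (x - z)" "f (v - z) = f (v - x) + f (x - z)"
        using f_add[of z "x - z"] f_add[of "v - x" "x - z"] that z by simp_all
      then show ?thesis
        by (simp only: ac_simps)
    qed
    then show ?thesis
      using that z by simp
  qed
  have split: "\<forall>\<^sub>F x in generic (*s). G x \<and> G (v - x)" for v
    by (intro eventually_conj G eventually_generic_shift(3)[OF G])
  define g where "g v = (let x = SOME x. G x \<and> G (v - x) in f x + f (v - x))" for v
  have g: "g v = f x + f (v - x)" if "G x" "G (v - x)" for v x
    unfolding g_def Let_def using someI[of "\<lambda>x. G x \<and> G (v - x)" x] that
    by (intro well_defined) auto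
  show thesis
  proof
    fix v w
    obtain x where x: "G x" "G (v - x)"
      using split[of v] by (rule eventually_generic_obtain) blast
    have "\<forall>\<^sub>F y in generic (*s). (G y \<and> G (w - y)) \<and> G (x + y) \<and> G ((v + w - x) - y)"
      by (intro eventually_conj split G eventually_generic_shift[OF G])
    then obtain y where y: "G y" "G (w - y)" "G (x + y)" "G (v + w - x - y)"
      by (rule eventually_generic_obtain) blast
    have "g (v + w) = f (x + y) + f (v + w - (x + y))"
      using y by (intro g) (simp_all add: diff_diff_eq)
    also have "v + w - (x + y) = (v - x) + (w - y)"
      by simp
    also have "f (x + y) + f ((v - x) + (w - y)) = f x + f y + (f (v - x) + f (w - y))"
    proof -
      have "G ((v - x) + (w - y))"
        using y(4) by (simp add: algebra_simps)
      then show ?thesis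
        using x y by (simp only: f_add)
    qed
    also have "\<dots> = g v + g w"
      unfolding g[OF x] g[OF y(1,2)] by (simp only: ac_simps)
    finally show "g (v + w) = g v + g w" .
  next
    fix v assume "G v"
    obtain x where x: "G x" "G (v - x)"
      using split[of v] by (rule eventually_generic_obtain) blast
    then show "g v = f v"
      using g[OF x] f_add[OF x] \<open>G v\<close> by (simp only: add_diff_cancel_left' diff_add_cancel add_diff_eq)
  qed
qed

end

end

section \<open>Zariski open sets\<close>

text \<open>
  The affine cone over a set of points, without its apex: openness of the set becomes a property of
  a set of vectors.
\<close>

definition cone :: "('k::field \<Rightarrow> 'v::ab_group_add \<Rightarrow> 'v) \<Rightarrow> 'v set set \<Rightarrow> 'v set" where
  "cone scale S = {v. v \<noteq> 0 \<and> module.span scale {v} \<in> S}"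

context vector_space
begin

lemma linear_forms_add: "f \<in> linear_forms (*s) \<Longrightarrow> f (x + y) = f x + f y"
  by (simp add: linear_forms_def Vector_Spaces.linear_iff)

lemma linear_forms_scale: "f \<in> linear_forms (*s) \<Longrightarrow> f (c *s x) = c * f x"
  by (simp add: linear_forms_def Vector_Spaces.linear_iff)

lemma linear_formsI:
  assumes "\<And>x y. f (x + y) = f x + f y" "\<And>c x. f (c *s x) = c * f x"
  shows "f \<in> linear_forms (*s)"
  using assms by (simp add: linear_forms_def Vector_Spaces.linear_iff vector_space_axioms)
    (unfold_locales, simp_all add: algebra_simps)

lemma homogeneous_poly_linear_forms_scale:
  assumes "homogeneous_poly (linear_forms (*s)) d F"
  shows "F (c *s v) = c ^ d * F v"
  using assms
proof induction
  case (coord f)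
  then show ?case
    by (simp add: linear_forms_scale)
qed (auto simp: algebra_simps power_add)

text \<open>
  A change of the spanning vectors multiplies every Pluecker coordinate by the determinant of the
  change of basis.
\<close>

lemma homogeneous_poly_plucker_coords_change_basis:
  assumes "homogeneous_poly (plucker_coords (*s)) d F"
  shows "F (a *s v + b *s w, a' *s v + b' *s w) = (a * b' - b * a') ^ d * F (v, w)"
  using assms
proof induction
  case (coord h)
  then obtain f g where h: "h = (\<lambda>(x, y). f x * g y - f y * g x)"
    and fg: "f \<in> linear_forms (*s)" "g \<in> linear_forms (*s)"
    by (auto simp: plucker_coords_def)
  show ?case
    by (simp add: h fg[THEN linear_forms_add] fg[THEN linear_forms_scale] algebra_simps)
qed (auto simp: algebra_simps power_add)

lemma homogeneous_poly_along_line: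
  assumes "homogeneous_poly (linear_forms (*s)) d F"
  shows "\<exists>p. \<forall>t. F (x + t *s y) = poly p t"
  using assms
proof induction
  case (const c)
  show ?case
    by (intro exI[of _ "[:c:]"]) simp
next
  case (coord f)
  then show ?case
    by (intro exI[of _ "[:f x, f y:]"]) (simp add: linear_forms_add linear_forms_scale)
next
  case (add d F G)
  then show ?case
    by (metis poly_add)
next
  case (mult d F e G)
  then show ?case
    by (metis poly_mult)
qed

lemma linewise_cofinite_nonzero:
  assumes "homogeneous_poly (linear_forms (*s)) d F"
  shows "linewise_cofinite (*s) {v. F v \<noteq> 0}"
  unfolding linewise_cofinite_def
proof (intro allI impI)
  fix x y assume "\<exists>t. x + t *s y \<in> {v. F v \<noteq> 0}"
  moreover obtain p where p: "\<And>t. F (x + t *s y) = poly p t"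
    using homogeneous_poly_along_line[OF assms] by metis
  ultimately have "p \<noteq> 0"
    by auto
  then show "finite {t. x + t *s y \<notin> {v. F v \<noteq> 0}}"
    using poly_roots_finite[of p] by (simp add: p)
qed

lemma span_in_principal_open_points_iff:
  assumes "homogeneous_poly (linear_forms (*s)) d F" "v \<noteq> 0"
  shows "span {v} \<in> principal_open_points (*s) F \<longleftrightarrow> F v \<noteq> 0"
proof
  assume "span {v} \<in> principal_open_points (*s) F"
  then obtain x where "span {v} = span {x}" "F x \<noteq> 0"
    by (auto simp: principal_open_points_def)
  moreover from this obtain c where "x = c *s v"
    using span_base[of x "{x}"] span_singleton_iff[of x v] by auto
  ultimately show "F v \<noteq> 0"
    using homogeneous_poly_linear_forms_scale[OF assms(1)] by auto
next
  assume "F v \<noteq> 0"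
  then show "span {v} \<in> principal_open_points (*s) F"
    using assms(2) by (auto simp: principal_open_points_def proj_points_iff)
qed

lemma linewise_cofinite_cone:
  assumes "openin (zariski_points (*s)) S"
  shows "linewise_cofinite (*s) (cone (*s) S)"
proof -
  have "generate_topology_on {principal_open_points (*s) F | F d. homogeneous_poly (linear_forms (*s)) d F} S"
    using assms unfolding zariski_points_def by (rule openin_topology_generated_by)
  then show ?thesis
  proof induction
    case Empty
    show ?case
      by (simp add: cone_def linewise_cofinite_def)
  next
    case (Int A B)
    moreover have "cone (*s) (A \<inter> B) = cone (*s) A \<inter> cone (*s) B"
      by (auto simp: cone_def)
    ultimately show ?case
      by (simp add: linewise_cofinite_Int)
  next
    case (UN \<A>)
    moreover have "cone (*s) (\<Union>\<A>) = \<Union>(cone (*s) ` \<A>)"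
      by (auto simp: cone_def)
    ultimately show ?case
      by (auto intro: linewise_cofinite_Union)
  next
    case (Basis A)
    then obtain F d where A: "A = principal_open_points (*s) F"
      and F: "homogeneous_poly (linear_forms (*s)) d F"
      by auto
    have "cone (*s) A = - {0} \<inter> {v. F v \<noteq> 0}"
      by (auto simp: cone_def A span_in_principal_open_points_iff[OF F])
    then show ?case
      using linewise_cofinite_Compl_subspace[of "{0}"] linewise_cofinite_nonzero[OF F]
      by (simp add: linewise_cofinite_Int)
  qed
qed

lemma exists_linear_form:
  assumes "v \<notin> span {w}"
  obtains f where "f \<in> linear_forms (*s)" "f w = 0" "f v \<noteq> 0"
proof -
  interpret vector_space_pair "(*s)" "(*) :: 'a \<Rightarrow> 'a \<Rightarrow> 'a"
    by unfold_locales (simp_all add: algebra_simps)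
  have "v \<noteq> 0" "v \<noteq> w"
    using assms span_zero span_base[of w "{w}"] by auto
  show thesis
  proof (cases "w = 0")
    case True
    have "independent {v}"
      using \<open>v \<noteq> 0\<close> by simp
    then obtain f where "Vector_Spaces.linear (*s) (*) f" "f v = 1"
      using linear_independent_extend[of "{v}" "\<lambda>_. 1"] by auto
    moreover from this have "f \<in> linear_forms (*s)"
      by (simp add: linear_forms_def)
    moreover from this have "f 0 = 0"
      using linear_forms_scale[of f 0 0] by simp
    ultimately show thesis
      using that True by simp
  next
    case False
    then obtain f where "Vector_Spaces.linear (*s) (*) f" "\<forall>x\<in>{v, w}. f x = (if x = v then 1 else 0)"
      using linear_independent_extend[OF independent_pair[OF False assms], of "\<lambda>x. if x = v then 1 else 0"]
      by blast
    then show thesis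
      using that \<open>v \<noteq> w\<close> by (simp add: linear_forms_def)
  qed
qed

text \<open>
  The points different from \<open>\<langle>w\<rangle>\<close> (all points, if \<open>w = 0\<close>) are where some linear form vanishing at
  \<open>w\<close> is nonzero.
\<close>

lemma openin_points_off_point:
  "openin (zariski_points (*s)) {span {v} | v. v \<notin> span {w}}" (is "openin _ ?S")
proof -
  let ?\<F> = "{f \<in> linear_forms (*s). f w = 0}"
  have "?S = \<Union>(principal_open_points (*s) ` ?\<F>)"
  proof (intro equalityI subsetI)
    fix p assume "p \<in> ?S"
    then obtain v where v: "p = span {v}" "v \<notin> span {w}"
      by auto
    then obtain f where "f \<in> linear_forms (*s)" "f w = 0" "f v \<noteq> 0"
      using exists_linear_form by metis
    moreover have "v \<noteq> 0"
      using v span_zero by auto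
    ultimately show "p \<in> \<Union>(principal_open_points (*s) ` ?\<F>)"
      using v by (auto simp: principal_open_points_def proj_points_iff)
  next
    fix p assume "p \<in> \<Union>(principal_open_points (*s) ` ?\<F>)"
    then obtain f v where f: "f \<in> linear_forms (*s)" "f w = 0" and v: "p = span {v}" "f v \<noteq> 0"
      by (auto simp: principal_open_points_def)
    have "f (c *s w) = 0" for c
      using homogeneous_poly_linear_forms_scale[OF homogeneous_poly.coord[OF f(1)]] f(2) by simp
    then have "v \<notin> span {w}"
      using v(2) by (auto simp: span_singleton_iff)
    then show "p \<in> ?S"
      using v(1) by auto
  qed
  moreover have "openin (zariski_points (*s)) (principal_open_points (*s) f)" if "f \<in> ?\<F>" for f
    unfolding zariski_points_def using that
    by (intro topology_generated_by_Basis) (blast intro: homogeneous_poly.coord)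
  ultimately show ?thesis
    by (auto intro: openin_Union)
qed

lemma plucker_coords_fix_second:
  assumes "homogeneous_poly (plucker_coords (*s)) d F"
  shows "homogeneous_poly (linear_forms (*s)) d (\<lambda>v. F (v, w))"
  using assms
proof induction
  case (coord h)
  then obtain f g where h: "h = (\<lambda>(x, y). f x * g y - f y * g x)"
    and fg: "f \<in> linear_forms (*s)" "g \<in> linear_forms (*s)"
    by (auto simp: plucker_coords_def)
  have "(\<lambda>v. h (v, w)) \<in> linear_forms (*s)"
    by (intro linear_formsI) (simp_all add: h fg[THEN linear_forms_add] fg[THEN linear_forms_scale] algebra_simps)
  then show ?case
    by (rule homogeneous_poly.coord)
qed (auto intro: homogeneous_poly.intros)

lemma span_in_principal_open_lines_iff:
  assumes "homogeneous_poly (plucker_coords (*s)) d F" "span {v, w} \<in> proj_lines (*s)"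
  shows "span {v, w} \<in> principal_open_lines (*s) F \<longleftrightarrow> F (v, w) \<noteq> 0"
proof
  assume "span {v, w} \<in> principal_open_lines (*s) F"
  then obtain x y where xy: "span {v, w} = span {x, y}" "F (x, y) \<noteq> 0"
    by (auto simp: principal_open_lines_def)
  then have "x \<in> span {v, w}" "y \<in> span {v, w}"
    by (simp_all add: span_base)
  then obtain a b a' b' where "x = a *s v + b *s w" "y = a' *s v + b' *s w"
    by (auto simp: span_pair_iff)
  then show "F (v, w) \<noteq> 0"
    using xy homogeneous_poly_plucker_coords_change_basis[OF assms(1)] by auto
next
  assume "F (v, w) \<noteq> 0"
  then show "span {v, w} \<in> principal_open_lines (*s) F"
    using assms(2) by (auto simp: principal_open_lines_def)
qed

text \<open>
  With one of the two spanning vectors fixed, Pluecker coordinates become linear forms in the other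
  one, so polynomial conditions on the line turn into polynomial conditions on the point.
\<close>

lemma openin_points_joined:
  assumes "openin (zariski_lines (*s)) U"
  shows "openin (zariski_points (*s)) {span {v} | v. span {v, w} \<in> U}"
proof -
  let ?P = "\<lambda>A. {span {v} | v. span {v, w} \<in> A}"
  have "generate_topology_on {principal_open_lines (*s) F | F d. homogeneous_poly (plucker_coords (*s)) d F} U"
    using assms unfolding zariski_lines_def by (rule openin_topology_generated_by)
  then show ?thesis
  proof induction
    case Empty
    show ?case
      by simp
  next
    case (Int A B)
    have "?P (A \<inter> B) = ?P A \<inter> ?P B"
    proof (intro equalityI subsetI)
      fix p assume "p \<in> ?P A \<inter> ?P B"
      then obtain v v' where "p = span {v}" "span {v, w} \<in> A" "p = span {v'}" "span {v', w} \<in> B"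
        by blast
      moreover from this have "span {v', w} = span {v, w}"
        by (intro span_pair_cong) simp
      ultimately show "p \<in> ?P (A \<inter> B)"
        by auto
    qed blast
    then show ?case
      using openin_Int[OF Int.IH] by simp
  next
    case (UN \<A>)
    have "?P (\<Union>\<A>) = \<Union>(?P ` \<A>)"
      by auto
    then show ?case
      using openin_Union[of "?P ` \<A>"] UN.IH by auto
  next
    case (Basis A)
    then obtain F d where A: "A = principal_open_lines (*s) F"
      and F: "homogeneous_poly (plucker_coords (*s)) d F"
      by auto
    (* A nonzero constant F does not vanish at a v in span {w} either, although v and w then span
       no line; such points have to be cut out separately. *)
    let ?Q = "principal_open_points (*s) (\<lambda>v. F (v, w)) \<inter> {span {v} | v. v \<notin> span {w}}"
    have lineD: "l \<in> proj_lines (*s)" if "l \<in> A" for l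
      using that by (simp add: A principal_open_lines_def)
    have iff: "span {v, w} \<in> A \<longleftrightarrow> F (v, w) \<noteq> 0" if "w \<noteq> 0" "v \<notin> span {w}" for v
      unfolding A using that by (intro span_in_principal_open_lines_iff[OF F]) (simp add: proj_lines_span_iff)
    have "?P A = (if w = 0 then {} else ?Q)"
    proof (cases "w = 0")
      case True
      then show ?thesis
        using lineD proj_lines_span_iff[of _ 0] by auto
    next
      case False
      have "span {v} \<in> ?Q \<longleftrightarrow> span {v, w} \<in> A" for v
      proof (cases "v \<in> span {w}")
        case True
        then have "span {v} \<noteq> span {v'}" if "v' \<notin> span {w}" for v'
          using that span_minimal[of "{v}" "span {w}"] span_base[of v' "{v'}"] by auto
        moreover have "span {v, w} \<notin> A"
          using True lineD proj_lines_span_iff by blast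
        ultimately show ?thesis
          by auto
      next
        case v: False
        then have "v \<noteq> 0"
          using span_zero by auto
        then show ?thesis
          using v iff[OF False v] span_in_principal_open_points_iff[OF plucker_coords_fix_second[OF F]]
          by auto
      qed
      moreover have "\<exists>v. p = span {v}" if "p \<in> ?Q" for p
        using that by auto
      ultimately have "?P A = ?Q"
        by blast
      then show ?thesis
        using False by simp
    qed
    moreover have "openin (zariski_points (*s)) (principal_open_points (*s) (\<lambda>v. F (v, w)))"
      unfolding zariski_points_def using plucker_coords_fix_second[OF F]
      by (intro topology_generated_by_Basis) blast
    ultimately show ?case
      by (simp add: openin_Int openin_points_off_point)
  qed
qed

lemma linewise_cofinite_joined:
  assumes "openin (zariski_lines (*s)) U"
  shows "linewise_cofinite (*s) {v. span {v, w} \<in> U}"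
proof -
  have "U \<subseteq> proj_lines (*s)"
    using openin_subset[OF assms] topspace_zariski_lines[OF vector_space_axioms] by simp
  then have "v \<noteq> 0" if "span {v, w} \<in> U" for v
    using that proj_lines_span_iff[of v w] span_zero by auto
  then have "cone (*s) {span {v} | v. span {v, w} \<in> U} = {v. span {v, w} \<in> U}"
  proof (intro equalityI subsetI)
    fix v assume "v \<in> cone (*s) {span {v} | v. span {v, w} \<in> U}"
    then obtain v' where "span {v} = span {v'}" "span {v', w} \<in> U"
      by (auto simp: cone_def)
    then show "v \<in> {v. span {v, w} \<in> U}"
      using span_pair_cong[of v v' w] by simp
  qed (auto simp: cone_def)
  then show ?thesis
    using linewise_cofinite_cone[OF openin_points_joined[OF assms, of w]] by simp
qed

lemma sweep_eq:
  assumes "U \<subseteq> proj_lines (*s)"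
  shows "sweep (*s) U = (\<Union>w. {span {v} | v. span {v, w} \<in> U})"
proof (intro equalityI subsetI)
  fix p assume "p \<in> sweep (*s) U"
  then obtain l v where l: "l \<in> U" "v \<noteq> 0" "p = span {v}" "span {v} \<subseteq> l"
    by (auto simp: sweep_def points_on_def proj_points_iff)
  moreover have "v \<in> l"
    using l(4) span_base[of v "{v}"] by auto
  ultimately obtain w where "l = span {v, w}"
    using assms proj_line_through[of l v] by blast
  then show "p \<in> (\<Union>w. {span {v} | v. span {v, w} \<in> U})"
    using l by auto
next
  fix p assume "p \<in> (\<Union>w. {span {v} | v. span {v, w} \<in> U})"
  then obtain v w where p: "p = span {v}" "span {v, w} \<in> U"
    by auto
  then have "v \<noteq> 0"
    using assms proj_lines_span_iff[of v w] span_zero by auto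
  moreover have "span {v} \<subseteq> span {v, w}"
    by (intro span_mono) simp
  ultimately show "p \<in> sweep (*s) U"
    using p by (auto simp: sweep_def points_on_def proj_points_iff)
qed

text \<open>
  Projective space over an infinite field is irreducible: the cones over two nonempty open sets
  have a common vector, since any two nonempty \<open>linewise_cofinite\<close> sets do.
\<close>

lemma dense_open_nonempty:
  assumes infinite: "infinite (UNIV :: 'a set)"
    and S: "openin (zariski_points (*s)) S" "S \<noteq> {}"
  shows "dense_open (zariski_points (*s)) S"
proof -
  let ?Z = "zariski_points (*s)"
  have top: "topspace ?Z = proj_points (*s)"
    using topspace_zariski_points vector_space_axioms .
  have cone: "\<exists>v. v \<in> cone (*s) T" if "openin ?Z T" "T \<noteq> {}" for T
    using that openin_subset[OF that(1)] by (fastforce simp: top cone_def proj_points_iff)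
  have "S \<inter> T \<noteq> {}" if T: "openin ?Z T" "T \<noteq> {}" for T
  proof -
    obtain v w where "v \<in> cone (*s) S" "w \<in> cone (*s) T"
      using cone[OF S] cone[OF T] by blast
    then have "cone (*s) S \<inter> cone (*s) T \<noteq> {}"
      using S T by (intro linewise_cofinite_Int_nonempty[OF infinite] linewise_cofinite_cone)
    then show ?thesis
      by (auto simp: cone_def)
  qed
  then have "?Z closure_of S = topspace ?Z"
    unfolding closure_of_def by blast
  then show ?thesis
    using S by (simp add: dense_open_def)
qed

lemma dense_open_sweep:
  assumes "infinite (UNIV :: 'a set)" "openin (zariski_lines (*s)) U" "U \<noteq> {}"
  shows "dense_open (zariski_points (*s)) (sweep (*s) U)"
proof -
  have U: "U \<subseteq> proj_lines (*s)"
    using openin_subset[OF assms(2)] topspace_zariski_lines[OF vector_space_axioms] by simp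
  obtain l where "l \<in> U"
    using assms(3) by blast
  moreover from this obtain v w where "l = span {v, w}"
    using U proj_line_cases by blast
  ultimately have "sweep (*s) U \<noteq> {}"
    by (auto simp: sweep_eq[OF U])
  moreover have "openin (zariski_points (*s)) (sweep (*s) U)"
    unfolding sweep_eq[OF U] using openin_points_joined[OF assms(2)] by (intro openin_Union) auto
  ultimately show ?thesis
    using dense_open_nonempty[OF assms(1)] by blast
qed

end

section \<open>Collineations defined on generic lines\<close>

text \<open>
  Genericity of \<open>U\<close> is asked of the lines through one vector at a time, because the vectors of every
  configuration below are chosen one after the other.
\<close>

locale generic_collineation =
  V1: vector_space s1 + V2: vector_space s2
  for s1 :: "'k1::field \<Rightarrow> 'v1::ab_group_add \<Rightarrow> 'v1"
    and s2 :: "'k2::field \<Rightarrow> 'v2::ab_group_add \<Rightarrow> 'v2" +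
  fixes U :: "'v1 set set" and \<phi> :: "'v1 set \<Rightarrow> 'v2 set"
  assumes infinite_scalars: "infinite (UNIV :: 'k1 set)"
    and span_pair_neq_UNIV: "V1.span {v, w} \<noteq> UNIV"
    and U_lines: "U \<subseteq> proj_lines s1"
    and U_nonempty: "U \<noteq> {}"
    and U_linewise_cofinite: "linewise_cofinite s1 {v. V1.span {v, w} \<in> U}"
    and \<phi>_points: "p \<in> proj_points s1 \<Longrightarrow> \<phi> p \<in> proj_points s2"
    and \<phi>_inj: "inj_on \<phi> (proj_points s1)"
    and \<phi>_lines: "l \<in> U \<Longrightarrow> \<exists>m \<in> proj_lines s2. \<phi> ` points_on s1 l = points_on s2 m"
begin

definition joined :: "'v1 \<Rightarrow> 'v1 \<Rightarrow> bool" where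
  "joined v w \<longleftrightarrow> V1.span {v, w} \<in> U"

definition represents :: "'v2 \<Rightarrow> 'v1 \<Rightarrow> bool" where
  "represents h v \<longleftrightarrow> h \<noteq> 0 \<and> v \<noteq> 0 \<and> \<phi> (V1.span {v}) = V2.span {h}"

lemma joined_commute: "joined v w \<longleftrightarrow> joined w v"
  by (simp add: joined_def insert_commute)

lemma joinedD:
  assumes "joined v w"
  shows "w \<noteq> 0" "v \<notin> V1.span {w}" "v \<noteq> 0" "w \<notin> V1.span {v}"
proof -
  have "V1.span {v, w} \<in> proj_lines s1" "V1.span {w, v} \<in> proj_lines s1"
    using assms U_lines by (auto simp: joined_def insert_commute)
  then show "w \<noteq> 0" "v \<notin> V1.span {w}" "v \<noteq> 0" "w \<notin> V1.span {v}"
    unfolding V1.proj_lines_span_iff by blast+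
qed

lemma joined_change:
  assumes "joined v w" "x \<in> V1.span {v, w}" "y \<in> V1.span {v, w}"
    "v \<in> V1.span {x, y}" "w \<in> V1.span {x, y}"
  shows "joined x y"
  using assms V1.span_pair_eqI[of x v w y] by (simp add: joined_def)

lemma joined_add_left:
  assumes "joined v w"
  shows "joined (v + w) w" "joined (v + w) v"
proof -
  have "w = (v + w) - v" "v = (v + w) - w"
    by simp_all
  then have "w \<in> V1.span {v + w, v}" "v \<in> V1.span {v + w, w}"
    by (metis V1.span_base V1.span_diff insertCI)+
  then show "joined (v + w) w" "joined (v + w) v"
    by (auto intro!: joined_change[OF assms] V1.span_add simp: V1.span_base)
qed

lemma joined_scale:
  assumes "joined v w" "c \<noteq> 0"
  shows "joined v (s1 c w)"
proof (rule joined_change[OF assms(1)])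
  show "w \<in> V1.span {v, s1 c w}"
    using assms(2) V1.scale_in_span_cancel[of c w] by (simp add: V1.span_base)
qed (simp_all add: V1.span_base V1.span_scale)

lemma eventually_joined:
  assumes "joined v w"
  shows "\<forall>\<^sub>F x in generic s1. joined v x"
  unfolding V1.eventually_generic_iff[OF infinite_scalars]
  using assms U_linewise_cofinite[of v] joined_commute
  by (intro exI[of _ "{x. joined x v}"]) (auto simp: joined_def[abs_def])

lemma eventually_not_in_span_pair: "\<forall>\<^sub>F x in generic s1. x \<notin> V1.span {v, w}"
  using span_pair_neq_UNIV by (intro V1.eventually_generic_not_in_subspace infinite_scalars) auto

lemma represents_exists: "v \<noteq> 0 \<Longrightarrow> \<exists>h. represents h v"
  using \<phi>_points[of "V1.span {v}"] by (auto simp: represents_def V1.proj_points_iff V2.proj_points_iff)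

lemma represents_scale:
  assumes "represents h v" "c \<noteq> 0"
  shows "represents (s2 c h) v"
  using assms by (simp add: represents_def V2.scale_span_singleton)

lemma represents_scale_point:
  assumes "represents h v" "c \<noteq> 0"
  shows "represents h (s1 c v)"
  using assms by (simp add: represents_def V1.scale_span_singleton)

lemma represents_unique:
  assumes "represents h v" "represents k v"
  obtains c where "c \<noteq> 0" "k = s2 c h"
proof -
  have "k \<in> V2.span {h}" "k \<noteq> 0"
    using assms V2.span_base[of k "{k}"] by (simp_all add: represents_def)
  then show thesis
    using that by (auto simp: V2.span_singleton_iff)
qed

lemma represents_inj:
  assumes "represents h v" "represents k w" "k \<in> V2.span {h}"
  shows "w \<in> V1.span {v}"
proof -
  have "V2.span {k} = V2.span {h}"
    using assms by (intro V2.span_singleton_eq) (auto simp: represents_def)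
  then have "\<phi> (V1.span {w}) = \<phi> (V1.span {v})"
    using assms by (simp add: represents_def)
  then have "V1.span {w} = V1.span {v}"
    using assms by (intro inj_onD[OF \<phi>_inj]) (auto simp: represents_def V1.proj_points_iff)
  then show ?thesis
    using V1.span_base[of w "{w}"] by simp
qed

lemma joined_representatives:
  assumes "joined v w" "represents h v" "represents k w"
  shows "k \<noteq> 0" "h \<notin> V2.span {k}"
  using assms represents_inj[of k w h v] joinedD[OF assms(1)] by (auto simp: represents_def)

lemma image_of_joining_line:
  assumes "joined v w" "represents h v" "represents k w"
  shows "\<phi> ` points_on s1 (V1.span {v, w}) = points_on s2 (V2.span {h, k})"
proof -
  obtain m where m: "m \<in> proj_lines s2" "\<phi> ` points_on s1 (V1.span {v, w}) = points_on s2 m"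
    using \<phi>_lines assms(1) unfolding joined_def by blast
  have "z \<in> m" if "represents z x" "x \<in> V1.span {v, w}" for x z
  proof -
    have "V1.span {x} \<in> points_on s1 (V1.span {v, w})"
      using that V1.span_minimal[of "{x}" "V1.span {v, w}"]
      by (auto simp: points_on_def V1.proj_points_iff represents_def)
    then have "\<phi> (V1.span {x}) \<in> points_on s2 m"
      using m(2) by blast
    then show ?thesis
      using that(1) V2.span_base[of z "{z}"] by (auto simp: points_on_def represents_def)
  qed
  then have "h \<in> m" "k \<in> m"
    using assms by (auto simp: V1.span_base)
  then have "m = V2.span {h, k}"
    using V2.proj_lines_eq_span[OF m(1)] joined_representatives[OF assms] by blast
  then show ?thesis
    using m(2) by simp
qed

lemma represents_on_line:
  assumes "joined v w" "represents h v" "represents k w" "represents z x" "x \<in> V1.span {v, w}"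
  shows "z \<in> V2.span {h, k}"
proof -
  have "V1.span {x} \<in> points_on s1 (V1.span {v, w})"
    using assms V1.span_minimal[of "{x}" "V1.span {v, w}"]
    by (auto simp: points_on_def V1.proj_points_iff represents_def)
  then have "V2.span {z} \<in> points_on s2 (V2.span {h, k})"
    using assms(4) image_of_joining_line[OF assms(1-3)] by (auto simp: represents_def)
  then show ?thesis
    using V2.span_base[of z "{z}"] by (auto simp: points_on_def)
qed

lemma represents_onto_line:
  assumes "joined v w" "represents h v" "represents k w" "z \<in> V2.span {h, k}" "z \<noteq> 0"
  obtains x where "x \<in> V1.span {v, w}" "represents z x"
proof -
  have "V2.span {z} \<in> points_on s2 (V2.span {h, k})"
    using assms V2.span_minimal[of "{z}" "V2.span {h, k}"]
    by (auto simp: points_on_def V2.proj_points_iff)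
  then obtain p where p: "p \<in> points_on s1 (V1.span {v, w})" "\<phi> p = V2.span {z}"
    using image_of_joining_line[OF assms(1-3)] by (metis imageE)
  then obtain x where "x \<noteq> 0" "p = V1.span {x}"
    by (auto simp: points_on_def V1.proj_points_iff)
  then show thesis
    using that[of x] p assms(5) V1.span_base[of x "{x}"] by (auto simp: points_on_def represents_def)
qed

text \<open>
  Every point of the line joining the images is already the image of a point of the line, so
  injectivity keeps the other points away from it.
\<close>

lemma represents_off_line:
  assumes "joined v w" "represents h v" "represents k w" "represents z x" "x \<notin> V1.span {v, w}"
  shows "z \<notin> V2.span {h, k}"
proof
  assume "z \<in> V2.span {h, k}"
  moreover have "z \<noteq> 0"
    using assms(4) by (simp add: represents_def)
  ultimately obtain y where y: "y \<in> V1.span {v, w}" "represents z y"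
    using represents_onto_line[OF assms(1-3)] by blast
  then have "x \<in> V1.span {y}"
    using assms(4) represents_inj V2.span_base by blast
  then show False
    using assms(5) y(1) V1.span_minimal[of "{y}" "V1.span {v, w}"] by auto
qed

context
  fixes v0 :: 'v1 and h0 :: 'v2
  assumes base_represents: "represents h0 v0"
begin

text \<open>
  The vectors spanning \<open>\<phi> \<langle>v\<rangle>\<close> differ by scalars; prescribing the image of \<open>\<langle>v0 + v\<rangle>\<close> singles out one
  of them.
\<close>

definition lift :: "'v1 \<Rightarrow> 'v2" where
  "lift v = (SOME k. represents k v \<and> represents (h0 + k) (v0 + v))"

lemma lift_represents:
  assumes "joined v0 v"
  shows "represents (lift v) v" "represents (h0 + lift v) (v0 + v)"
proof -
  note v = joinedD[OF assms]
  have "v0 + v \<noteq> 0"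
    using v(2) V1.span_neg[of v "{v}"] by (auto simp: V1.span_base add_eq_0_iff2)
  then obtain k z where k: "represents k v" and z: "represents z (v0 + v)"
    using represents_exists v(1) by blast
  have "z \<in> V2.span {h0, k}"
    by (rule represents_on_line[OF assms base_represents k z]) (simp add: V1.span_base V1.span_add)
  then obtain a b where ab: "z = s2 a h0 + s2 b k"
    by (auto simp: V2.span_pair_iff)
  have "a \<noteq> 0"
  proof
    assume "a = 0"
    then have "v0 + v \<in> V1.span {v}"
      using ab by (intro represents_inj[OF k z]) (auto simp: V2.span_singleton_iff)
    then show False
      using v(2) V1.span_add_eq2[of v "{v}" v0] by (simp add: V1.span_base)
  qed
  have "b \<noteq> 0"
  proof
    assume "b = 0"
    then have "v0 + v \<in> V1.span {v0}"
      using ab by (intro represents_inj[OF base_represents z]) (auto simp: V2.span_singleton_iff)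
    then show False
      using v(4) V1.span_add_eq[of v0 "{v0}" v] by (simp add: V1.span_base)
  qed
  have "represents (s2 (inverse a * b) k) v"
    using represents_scale[OF k] \<open>a \<noteq> 0\<close> \<open>b \<noteq> 0\<close> by simp
  moreover have "represents (h0 + s2 (inverse a * b) k) (v0 + v)"
    using represents_scale[OF z, of "inverse a"] \<open>a \<noteq> 0\<close> ab by (simp add: V2.scale_right_distrib)
  ultimately have "\<exists>k. represents k v \<and> represents (h0 + k) (v0 + v)"
    by blast
  then have "represents (lift v) v \<and> represents (h0 + lift v) (v0 + v)"
    unfolding lift_def by (rule someI_ex)
  then show "represents (lift v) v" "represents (h0 + lift v) (v0 + v)"
    by auto
qed

text \<open>
  The vectors \<open>h0\<close>, \<open>lift v\<close>, \<open>lift w\<close> are independent because \<open>w\<close> is not on the line through \<open>v0\<close> and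
  \<open>v\<close>.  The line through \<open>v\<close> and \<open>w\<close> shows that \<open>lift (v + w)\<close> is a combination of \<open>lift v\<close> and
  \<open>lift w\<close>; the two lines through \<open>v0 + v + w\<close> then force both coefficients to be \<open>1\<close>.
\<close>

lemma lift_add:
  assumes "joined v0 v" "joined v0 w" "joined v0 (v + w)" "joined v w"
    and "joined (v0 + v) w" "joined (v0 + w) v" "w \<notin> V1.span {v0, v}"
  shows "lift (v + w) = lift v + lift w"
proof -
  note v = lift_represents[OF assms(1)] and w = lift_represents[OF assms(2)]
    and vw = lift_represents[OF assms(3)]
  have unique: "a = a' \<and> b = b' \<and> c = c'"
    if "s2 a (lift w) + s2 b h0 + s2 c (lift v) = s2 a' (lift w) + s2 b' h0 + s2 c' (lift v)"
    for a b c a' b' c'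
    using joined_representatives[OF assms(1) base_represents v(1)]
      represents_off_line[OF assms(1) base_represents v(1) w(1) assms(7)] that
    by (rule V2.coeffs_unique_triple)
  have "lift (v + w) \<in> V2.span {lift v, lift w}"
    by (rule represents_on_line[OF assms(4) v(1) w(1) vw(1)]) (simp add: V1.span_base V1.span_add)
  then obtain a b where ab: "lift (v + w) = s2 a (lift v) + s2 b (lift w)"
    by (auto simp: V2.span_pair_iff)
  have "h0 + lift (v + w) \<in> V2.span {h0 + lift v, lift w}"
    by (rule represents_on_line[OF assms(5) v(2) w(1) vw(2)])
      (simp add: V1.span_base V1.span_add flip: add.assoc)
  then obtain c d where "h0 + lift (v + w) = s2 c (h0 + lift v) + s2 d (lift w)"
    by (auto simp: V2.span_pair_iff)
  then have "s2 b (lift w) + s2 1 h0 + s2 a (lift v) = s2 d (lift w) + s2 c h0 + s2 c (lift v)"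
    by (simp add: ab V2.scale_right_distrib ac_simps)
  then have "a = 1"
    using unique by blast
  have "h0 + lift (v + w) \<in> V2.span {h0 + lift w, lift v}"
  proof (rule represents_on_line[OF assms(6) w(2) v(1) vw(2)])
    have "v0 + (v + w) = (v0 + w) + v"
      by (simp add: ac_simps)
    then show "v0 + (v + w) \<in> V1.span {v0 + w, v}"
      by (simp only:) (simp add: V1.span_base V1.span_add)
  qed
  then obtain c d where "h0 + lift (v + w) = s2 c (h0 + lift w) + s2 d (lift v)"
    by (auto simp: V2.span_pair_iff)
  then have "s2 b (lift w) + s2 1 h0 + s2 a (lift v) = s2 c (lift w) + s2 c h0 + s2 d (lift v)"
    by (simp add: ab V2.scale_right_distrib ac_simps)
  then have "b = 1"
    using unique by blast
  with \<open>a = 1\<close> ab show ?thesis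
    by simp
qed

lemma lift_add_generic:
  assumes "joined v0 v"
  shows "\<forall>\<^sub>F w in generic s1. lift (v + w) = lift v + lift w"
proof -
  note shift = V1.eventually_generic_shift(1)[OF infinite_scalars]
  have v: "joined v v0" "joined (v0 + v) v"
    using assms joined_add_left joined_commute by blast+
  have "\<forall>\<^sub>F w in generic s1. joined v0 w \<and> joined v0 (v + w) \<and> joined v w \<and>
      joined (v0 + v) w \<and> joined v (v0 + w) \<and> w \<notin> V1.span {v0, v}"
    by (intro eventually_conj eventually_joined[OF assms] shift[OF eventually_joined[OF assms]]
        eventually_joined[OF v(1)] eventually_joined[OF v(2)] shift[OF eventually_joined[OF v(1)]]
        eventually_not_in_span_pair)
  then show ?thesis
  proof (rule eventually_mono)
    fix w
    assume "joined v0 w \<and> joined v0 (v + w) \<and> joined v w \<and>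
      joined (v0 + v) w \<and> joined v (v0 + w) \<and> w \<notin> V1.span {v0, v}"
    then show "lift (v + w) = lift v + lift w"
      using assms joined_commute by (intro lift_add) auto
  qed
qed

context
  fixes \<psi> :: "'v1 \<Rightarrow> 'v2" and v1 :: 'v1
  assumes \<psi>_add: "\<psi> (v + w) = \<psi> v + \<psi> w"
    and \<psi>_lift: "joined v0 v \<Longrightarrow> \<psi> v = lift v"
    and v1: "joined v0 v1"
begin

text \<open>
  The companion field isomorphism of \<open>\<psi>\<close>, read off at the single generic vector \<open>v1\<close>.
\<close>

definition scalar_map :: "'k1 \<Rightarrow> 'k2" where
  "scalar_map a = (SOME c. \<psi> (s1 a v1) = s2 c (\<psi> v1))"

lemma \<psi>_zero: "\<psi> 0 = 0"
  using \<psi>_add[of 0 0] by simp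

lemma \<psi>_represents:
  assumes "joined v0 v"
  shows "represents (\<psi> v) v" "represents (h0 + \<psi> v) (v0 + v)"
  using lift_represents[OF assms] \<psi>_lift[OF assms] by simp_all

lemma eventually_split: "\<forall>\<^sub>F x in generic s1. joined v0 x \<and> joined v0 (v - x)"
  by (intro eventually_conj eventually_joined[OF v1]
      V1.eventually_generic_shift(3)[OF infinite_scalars eventually_joined[OF v1]])

lemma \<psi>_scale_exists:
  assumes "joined v0 v"
  shows "\<exists>c. \<psi> (s1 a v) = s2 c (\<psi> v)"
proof (cases "a = 0")
  case True
  then show ?thesis
    by (auto simp: \<psi>_zero intro: exI[of _ 0])
next
  case False
  then have "represents (\<psi> (s1 a v)) (s1 a v)" "represents (\<psi> v) (s1 a v)"
    using assms joined_scale \<psi>_represents(1) represents_scale_point by blast+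
  then show ?thesis
    using represents_unique by metis
qed

text \<open>
  If \<open>d\<close> and \<open>e\<close> are the factors for \<open>w\<close> and \<open>v + w\<close>, then additivity gives
  \<open>c \<psi>(v) + d \<psi>(w) = e \<psi>(v) + e \<psi>(w)\<close>, and the two vectors are independent.
\<close>

lemma \<psi>_scale_transfer:
  assumes "joined v0 v" "joined v0 w" "joined v0 (v + w)" "w \<notin> V1.span {v}"
    and "\<psi> (s1 a v) = s2 c (\<psi> v)"
  shows "\<psi> (s1 a w) = s2 c (\<psi> w)"
proof -
  obtain d e where d: "\<psi> (s1 a w) = s2 d (\<psi> w)" and e: "\<psi> (s1 a (v + w)) = s2 e (\<psi> (v + w))"
    using \<psi>_scale_exists assms(2,3) by blast
  have "s2 d (\<psi> w) + s2 c (\<psi> v) = s2 e (\<psi> w) + s2 e (\<psi> v)"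
    using e by (simp add: V1.scale_right_distrib V2.scale_right_distrib \<psi>_add assms(5) d add.commute)
  moreover have "\<psi> v \<noteq> 0" "\<psi> w \<notin> V2.span {\<psi> v}"
    using \<psi>_represents(1)[OF assms(1)] \<psi>_represents(1)[OF assms(2)] assms(4)
      represents_inj[of "\<psi> v" v "\<psi> w" w] by (auto simp: represents_def)
  ultimately have "c = d"
    using V2.coeffs_unique_pair by blast
  then show ?thesis
    using d by simp
qed

lemma \<psi>_v1_nonzero: "\<psi> v1 \<noteq> 0"
  using \<psi>_represents(1)[OF v1] by (simp add: represents_def)

lemma \<psi>_scale_v1: "\<psi> (s1 a v1) = s2 (scalar_map a) (\<psi> v1)"
  unfolding scalar_map_def using \<psi>_scale_exists[OF v1] by (rule someI_ex)

lemma \<psi>_scale: "\<psi> (s1 a v) = s2 (scalar_map a) (\<psi> v)"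
proof -
  (* A generic u is independent of v1 and of w, and carries the factor from v1 to w. *)
  have joined_case: "\<psi> (s1 a w) = s2 (scalar_map a) (\<psi> w)" if w: "joined v0 w" for w
  proof -
    note generic = eventually_joined[OF v1]
    note shift = V1.eventually_generic_shift(1,2)[OF infinite_scalars generic]
    have "\<forall>\<^sub>F u in generic s1. joined v0 u \<and> joined v0 (v1 + u) \<and> joined v0 (u + w) \<and>
        u \<notin> V1.span {v1, w}"
      by (intro eventually_conj generic shift eventually_not_in_span_pair)
    then obtain u where u: "joined v0 u" "joined v0 (v1 + u)" "joined v0 (u + w)"
      and "u \<notin> V1.span {v1, w}"
      by (rule V1.eventually_generic_obtain[OF infinite_scalars]) blast
    then have "u \<notin> V1.span {v1}" "u \<notin> V1.span {w}"
      using V1.span_mono[of "{v1}" "{v1, w}"] V1.span_mono[of "{w}" "{v1, w}"] by auto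
    moreover have "w \<notin> V1.span {u}"
    proof
      assume "w \<in> V1.span {u}"
      then have "V1.span {w} = V1.span {u}"
        using joinedD(1)[OF w] by (rule V1.span_singleton_eq)
      then show False
        using \<open>u \<notin> V1.span {w}\<close> by (simp add: V1.span_base)
    qed
    ultimately show ?thesis
      using \<psi>_scale_transfer[OF v1 u(1,2)] \<psi>_scale_transfer[OF u(1) w u(3)] \<psi>_scale_v1 by blast
  qed
  obtain x where x: "joined v0 x" "joined v0 (v - x)"
    using eventually_split by (rule V1.eventually_generic_obtain[OF infinite_scalars]) blast
  have "\<psi> (s1 a v) = \<psi> (s1 a x) + \<psi> (s1 a (v - x))"
    by (simp flip: \<psi>_add V1.scale_right_distrib)
  also have "\<dots> = s2 (scalar_map a) (\<psi> x + \<psi> (v - x))"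
    using x by (simp add: joined_case V2.scale_right_distrib)
  also have "\<psi> x + \<psi> (v - x) = \<psi> v"
    by (simp flip: \<psi>_add)
  finally show ?thesis .
qed

text \<open>
  The point spanned by \<open>h0 + c \<psi>(v1)\<close> lies on the image of the line through \<open>v0\<close> and \<open>v1\<close>, which is a
  whole line.  Its preimage is spanned by some \<open>v0 + b v1\<close>, and \<open>b\<close> is mapped to \<open>c\<close>.
\<close>

lemma scalar_map_surj: "\<exists>b. scalar_map b = c"
proof -
  let ?z = "h0 + s2 c (\<psi> v1)"
  note rep = \<psi>_represents[OF v1]
  note indep = joined_representatives[OF v1 base_represents rep(1)]
  have "?z \<in> V2.span {h0, \<psi> v1}"
    by (simp add: V2.span_base V2.span_add V2.span_scale)
  moreover have "?z \<notin> V2.span {\<psi> v1}"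
    using indep(2) by (simp add: V2.span_add_eq2 V2.span_base V2.span_scale)
  then have "?z \<noteq> 0"
    using V2.span_zero by auto
  ultimately obtain x where x: "x \<in> V1.span {v0, v1}" "represents ?z x"
    using represents_onto_line[OF v1 base_represents rep(1)] by blast
  then obtain a b where ab: "x = s1 a v0 + s1 b v1"
    by (auto simp: V1.span_pair_iff)
  have "a \<noteq> 0"
  proof
    assume "a = 0"
    then have "b \<noteq> 0" "x = s1 b v1"
      using ab x(2) by (auto simp: represents_def)
    then have "represents (\<psi> v1) x"
      using rep(1) represents_scale_point by blast
    then obtain e where "?z = s2 e (\<psi> v1)"
      using x(2) by (rule represents_unique)
    then show False
      using \<open>?z \<notin> V2.span {\<psi> v1}\<close> by (auto simp: V2.span_singleton_iff)
  qed
  define b' where "b' = inverse a * b"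
  have "s1 (inverse a) x = v0 + s1 b' v1"
    using \<open>a \<noteq> 0\<close> by (simp add: ab b'_def V1.scale_right_distrib)
  then have z: "represents ?z (v0 + s1 b' v1)"
    using represents_scale_point[OF x(2), of "inverse a"] \<open>a \<noteq> 0\<close> by simp
  have "represents (h0 + \<psi> (s1 b' v1)) (v0 + s1 b' v1)"
  proof (cases "b' = 0")
    case True
    then show ?thesis
      using base_represents \<psi>_zero by simp
  next
    case False
    then show ?thesis
      using joined_scale[OF v1] \<psi>_represents(2) by blast
  qed
  then obtain e where "h0 + s2 c (\<psi> v1) = s2 e (h0 + \<psi> (s1 b' v1))"
    using z by (rule represents_unique)
  then have "s2 1 h0 + s2 c (\<psi> v1) = s2 e h0 + s2 (e * scalar_map b') (\<psi> v1)"
    by (simp add: \<psi>_scale V2.scale_right_distrib)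
  then have "c = scalar_map b'"
    using V2.coeffs_unique_pair[OF indep] by fastforce
  then show ?thesis
    by blast
qed

lemma field_iso_scalar_map: "field_iso scalar_map"
proof -
  have eqI: "c = d" if "s2 c (\<psi> v1) = s2 d (\<psi> v1)" for c d
    using that \<psi>_v1_nonzero by simp
  have one: "scalar_map 1 = 1"
    using \<psi>_scale[of 1 v1] by (intro eqI) simp
  have add: "scalar_map (a + b) = scalar_map a + scalar_map b" for a b
    by (intro eqI) (simp add: V1.scale_left_distrib V2.scale_left_distrib \<psi>_add flip: \<psi>_scale)
  have mult: "scalar_map (a * b) = scalar_map a * scalar_map b" for a b
  proof (rule eqI)
    have "s2 (scalar_map (a * b)) (\<psi> v1) = \<psi> (s1 a (s1 b v1))"
      by (simp add: \<psi>_scale[symmetric])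
    also have "\<dots> = s2 (scalar_map a * scalar_map b) (\<psi> v1)"
      by (simp only: \<psi>_scale V2.scale_scale)
    finally show "s2 (scalar_map (a * b)) (\<psi> v1) = s2 (scalar_map a * scalar_map b) (\<psi> v1)" .
  qed
  have "scalar_map a \<noteq> 0" if "a \<noteq> 0" for a
    using mult[of a "inverse a"] one that by auto
  moreover have "scalar_map a = scalar_map (a - b) + scalar_map b" for a b
    using add[of "a - b" b] by simp
  ultimately have "inj scalar_map"
    by (intro injI) (metis add_cancel_right_left right_minus_eq)
  then show ?thesis
    using scalar_map_surj one add mult unfolding field_iso_def bij_def surj_def by metis
qed

text \<open>
  As \<open>v\<close> may lie on no line of \<open>U\<close>, it is reached through generic vectors: if \<open>\<psi> v = 0\<close>, then
  \<open>\<psi> x\<close> and \<open>\<psi> (v - x)\<close> are opposite for generic \<open>x\<close>, although \<open>x\<close> and \<open>v - x\<close> span different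
  points.
\<close>

lemma \<psi>_nonzero:
  assumes "v \<noteq> 0"
  shows "\<psi> v \<noteq> 0"
proof
  assume "\<psi> v = 0"
  (* The pair {v, v} lets the statement about planes be applied to the line spanned by v. *)
  have "\<forall>\<^sub>F x in generic s1. (joined v0 x \<and> joined v0 (v - x)) \<and> x \<notin> V1.span {v, v}"
    by (intro eventually_conj eventually_split eventually_not_in_span_pair)
  then obtain x where x: "joined v0 x" "joined v0 (v - x)" "x \<notin> V1.span {v}"
    by (rule V1.eventually_generic_obtain[OF infinite_scalars]) auto
  have "\<psi> (v - x) = - \<psi> x"
    using \<psi>_add[of x "v - x"] \<open>\<psi> v = 0\<close> by (simp add: eq_neg_iff_add_eq_0 add.commute)
  then have "\<psi> (v - x) \<in> V2.span {\<psi> x}"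
    by (simp add: V2.span_base V2.span_neg)
  then have "v - x \<in> V1.span {x}"
    using x \<psi>_represents(1) represents_inj by blast
  then have "v \<in> V1.span {x}"
    using V1.span_add[of "v - x" "{x}" x] by (simp add: V1.span_base)
  then have "V1.span {v} = V1.span {x}"
    using assms by (rule V1.span_singleton_eq)
  then show False
    using x(3) by (simp add: V1.span_base)
qed

text \<open>
  For generic \<open>x\<close> the vector \<open>\<psi> v = \<psi> x + \<psi> (v - x)\<close> lies in the image of the line through \<open>v\<close> and
  \<open>x\<close>.  Two such lines in different directions have images meeting only in \<open>\<phi> \<langle>v\<rangle>\<close>.
\<close>

lemma \<psi>_represents_swept:
  assumes "joined v y"
  shows "represents (\<psi> v) v"
proof -
  obtain h where h: "represents h v"
    using joinedD(3)[OF assms] represents_exists by blast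
  have on_line: "\<psi> v \<in> V2.span {h, \<psi> x}" if "joined v0 x" "joined v0 (v - x)" "joined v x" for x
  proof -
    have "v - x \<in> V1.span {v, x}"
      by (simp add: V1.span_base V1.span_diff)
    then have "\<psi> (v - x) \<in> V2.span {h, \<psi> x}"
      using that by (intro represents_on_line[OF _ h]) (auto simp: \<psi>_represents)
    then have "\<psi> x + \<psi> (v - x) \<in> V2.span {h, \<psi> x}"
      by (simp add: V2.span_base V2.span_add)
    then show ?thesis
      by (simp flip: \<psi>_add)
  qed
  have generic: "\<forall>\<^sub>F x in generic s1. (joined v0 x \<and> joined v0 (v - x)) \<and> joined v x"
    by (intro eventually_conj eventually_split eventually_joined[OF assms])
  then obtain x where x: "joined v0 x" "joined v0 (v - x)" "joined v x"
    by (rule V1.eventually_generic_obtain[OF infinite_scalars]) blast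
  have "\<forall>\<^sub>F x' in generic s1. ((joined v0 x' \<and> joined v0 (v - x')) \<and> joined v x') \<and> x' \<notin> V1.span {v, x}"
    by (intro eventually_conj[OF generic] eventually_not_in_span_pair)
  then obtain x' where x': "joined v0 x'" "joined v0 (v - x')" "joined v x'" "x' \<notin> V1.span {v, x}"
    by (rule V1.eventually_generic_obtain[OF infinite_scalars]) blast
  obtain a b where ab: "\<psi> v = s2 a h + s2 b (\<psi> x)"
    using on_line[OF x] by (auto simp: V2.span_pair_iff)
  obtain a' b' where "\<psi> v = s2 a' h + s2 b' (\<psi> x')"
    using on_line[OF x'(1-3)] by (auto simp: V2.span_pair_iff)
  then have "s2 0 (\<psi> x') + s2 a h + s2 b (\<psi> x) = s2 b' (\<psi> x') + s2 a' h + s2 0 (\<psi> x)"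
    using ab by (simp add: add.commute)
  then have "b = 0"
    using V2.coeffs_unique_triple[OF joined_representatives[OF x(3) h \<psi>_represents(1)[OF x(1)]]
        represents_off_line[OF x(3) h \<psi>_represents(1)[OF x(1)] \<psi>_represents(1)[OF x'(1)] x'(4)]]
    by blast
  then have "\<psi> v = s2 a h"
    using ab by simp
  moreover from this have "a \<noteq> 0"
    using \<psi>_nonzero[OF joinedD(3)[OF assms]] by auto
  ultimately show ?thesis
    using represents_scale[OF h] by simp
qed

lemma semilinear_extension:
  "semilinear scalar_map s1 s2 \<psi>" "inj \<psi>" "\<And>p. p \<in> sweep s1 U \<Longrightarrow> proj_map \<psi> p = \<phi> p"
proof -
  show "semilinear scalar_map s1 s2 \<psi>"
    by (simp add: semilinear_def \<psi>_add \<psi>_scale)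
  have "\<psi> v = \<psi> (v - w) + \<psi> w" for v w
    by (simp flip: \<psi>_add)
  then show "inj \<psi>"
    using \<psi>_nonzero by (intro injI) (metis add_cancel_right_left right_minus_eq)
  fix p assume "p \<in> sweep s1 U"
  then obtain l v where l: "l \<in> U" "v \<noteq> 0" "p = V1.span {v}" "v \<in> l"
    by (auto simp: sweep_def points_on_def V1.proj_points_iff) (metis V1.span_base insertI1 subsetD)
  moreover from this obtain y where "l = V1.span {v, y}"
    using U_lines V1.proj_line_through by blast
  ultimately have "joined v y"
    by (simp add: joined_def)
  then have "represents (\<psi> v) v"
    using \<psi>_represents_swept by blast
  moreover have "\<psi> ` V1.span {v} = V2.span {\<psi> v}"
  proof -
    have "range scalar_map = UNIV"
      by (intro equalityI subsetI) (use scalar_map_surj in \<open>auto simp: image_iff eq_commute\<close>)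
    moreover have "\<psi> ` V1.span {v} = (\<lambda>c. s2 c (\<psi> v)) ` range scalar_map"
      by (simp add: V1.span_singleton image_image \<psi>_scale)
    ultimately show ?thesis
      by (simp add: V2.span_singleton)
  qed
  ultimately show "proj_map \<psi> p = \<phi> p"
    by (simp add: proj_map_def represents_def l(3))
qed

end

end

lemma exists_semilinear_map:
  "\<exists>\<sigma> \<psi>. field_iso \<sigma> \<and> semilinear \<sigma> s1 s2 \<psi> \<and> inj \<psi> \<and> (\<forall>p \<in> sweep s1 U. proj_map \<psi> p = \<phi> p)"
proof -
  obtain l where "l \<in> U"
    using U_nonempty by blast
  then obtain v0 v1 where v1: "joined v0 v1"
    using U_lines V1.proj_line_cases unfolding joined_def by (metis subsetD)
  obtain h0 where h0: "represents h0 v0"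
    using joinedD(3)[OF v1] represents_exists by blast
  obtain \<psi> where "\<And>v w. \<psi> (v + w) = \<psi> v + \<psi> w" "\<And>v. joined v0 v \<Longrightarrow> \<psi> v = lift v0 h0 v"
    using V1.generically_additive_extends[OF infinite_scalars eventually_joined[OF v1]
        lift_add_generic[OF h0]] by blast
  note \<psi> = h0 this v1
  show ?thesis
    using field_iso_scalar_map[OF \<psi>] semilinear_extension[OF \<psi>] by blast
qed

end

section \<open>Definable projective spaces\<close>

theorem theorem2p1p5:
  fixes scale1 :: "'k1::field \<Rightarrow> 'v1::ab_group_add \<Rightarrow> 'v1"
    and scale2 :: "'k2::field \<Rightarrow> 'v2::ab_group_add \<Rightarrow> 'v2"
    and U1 :: "'v1 set set" and U2 :: "'v2 set set"
    and \<phi> :: "'v1 set \<Rightarrow> 'v2 set"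
  assumes "definable_projective_space scale1 U1"
    and "definable_projective_space scale2 U2"
    and "\<exists>B1. finite_dimensional_vector_space scale1 B1"
    and "\<exists>B2. finite_dimensional_vector_space scale2 B2"
    and "proj_dim scale1 \<ge> 2"
    and "proj_dim scale2 \<ge> 2"
    and "\<phi> ` proj_points scale1 \<subseteq> proj_points scale2"
    and "inj_on \<phi> (proj_points scale1)"
    and "\<forall>l \<in> U1. \<exists>m \<in> U2. \<phi> ` points_on scale1 l = points_on scale2 m"
  shows "\<exists>\<sigma> \<psi>. field_iso \<sigma> \<and> semilinear \<sigma> scale1 scale2 \<psi> \<and> inj \<psi> \<and>
    (\<exists>O1. dense_open (zariski_points scale1) O1 \<and>
          sweep scale1 (open_part scale1 U1) \<subseteq> O1 \<and>
          (\<forall>p \<in> O1. proj_map \<psi> p = \<phi> p))"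
proof -
  let ?U = "open_part scale1 U1"
  have infinite: "infinite (UNIV :: 'k1 set)" and U1: "U1 \<subseteq> proj_lines scale1"
    and U2: "U2 \<subseteq> proj_lines scale2"
    using assms(1,2) by (simp_all add: definable_projective_space_def)
  interpret V1: vector_space scale1
    using assms(1) by (simp add: definable_projective_space_def)
  interpret V2: vector_space scale2
    using assms(2) by (simp add: definable_projective_space_def)
  have dim: "3 \<le> V1.dim (UNIV :: 'v1 set)"
    using assms(5) by (simp add: proj_dim_def)
  have U_open: "openin (zariski_lines scale1) ?U"
    by (simp add: open_part_def)
  have U_subset: "?U \<subseteq> U1"
    by (simp add: open_part_def interior_of_subset)
  have U_nonempty: "?U \<noteq> {}"
  proof -
    obtain D where D: "D \<subseteq> U1" "dense_open (zariski_lines scale1) D"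
      using assms(1) by (auto simp: definable_projective_space_def)
    then have "D \<noteq> {}"
      using V1.proj_lines_nonempty[OF dim] topspace_zariski_lines[OF V1.vector_space_axioms]
      by (auto simp: dense_open_def)
    moreover have "D \<subseteq> ?U"
      unfolding open_part_def using D by (intro interior_of_maximal) (simp_all add: dense_open_def)
    ultimately show ?thesis
      by blast
  qed
  interpret generic_collineation scale1 scale2 ?U \<phi>
  proof
    show "infinite (UNIV :: 'k1 set)"
      by fact
    show "V1.span {v, w} \<noteq> UNIV" for v w
      using V1.span_pair_neq_UNIV[OF dim] .
    show "?U \<subseteq> proj_lines scale1"
      using U_subset U1 by blast
    show "?U \<noteq> {}"
      by fact
    show "linewise_cofinite scale1 {v. V1.span {v, w} \<in> ?U}" for w
      using V1.linewise_cofinite_joined[OF U_open] .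
    show "\<phi> p \<in> proj_points scale2" if "p \<in> proj_points scale1" for p
      using assms(7) that by blast
    show "inj_on \<phi> (proj_points scale1)"
      by fact
    show "\<exists>m\<in>proj_lines scale2. \<phi> ` points_on scale1 l = points_on scale2 m" if "l \<in> ?U" for l
      using assms(9) U_subset U2 that by blast
  qed
  show ?thesis
    using exists_semilinear_map V1.dense_open_sweep[OF infinite U_open U_nonempty] by blast
qed

end
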